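(* Let $k\ge 1$ be an integer and let $p_r,p_a,p_h\in[0,1]$. Consider the homogeneous Independent Halting Cascade (IHC) branching process with parameters $(k,p_r,p_a,p_h)$ (defined in the context). Let $U\in[0,1]$ be the probability that a single activated (non-root) agent produces no halt at any depth, i.e. that neither the agent itself nor any of its descendants halts. Then $U$ satisfies $$U = p_a(1-p_h) + (1-p_a)\bigl(1-p_r+p_rU\bigr)^{k}.$$ Moreover, the probability $P_{\mathrm{fail}}(p_a,p_r)$ of overall failure, i.e. that no agent in the whole process started from the root ever halts, is $$P_{\mathrm{fail}}(p_a,p_r) = \bigl(1-p_r+p_rU\bigr)^{k}.$$ Define the failure boundary (for given $k$ and $p_h$) as the set of pairs $(p_a,p_r)$ with $P_{\mathrm{fail}}(p_a,p_r)=\tfrac12$. For parameters on the failure boundary, the probability that some agent eventually halts and the probability that the process dies out (the tree is finite) with no agent ever halting are equal (both equal $\tfrac12$).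
   Context: The homogeneous IHC branching process with parameters $k$ (number of recommendation trials per agent, the degree), $p_r$ (recommendation probability), $p_a$ (application probability) and $p_h$ (hiring probability) is the following random rooted tree whose non-root vertices carry decisions. The root agent does not apply; it performs $k$ independent recommendation trials, each succeeding with probability $p_r$, and each successful trial activates one neighbor, which becomes a child of the root. Thus the number of children of the root is distributed as $\mathrm{Bin}(k,p_r)$. Each activated (non-root) agent then behaves independently of everything else, as follows: with probability $p_a$ it applies, in which case it halts (is hired) with probability $p_h$, and with probability $1-p_h$ it fails, having no children in either case; with probability $1-p_a$ it does not apply and instead performs $k$ new independent recommendation trials, each succeeding with probability $p_r$ and each success activating one new child. The tree may be infinite. *)

theory Defs
  imports "HOL-Probability.Probability"
begin

text \<open>
  Potential agents are labelled by lists of trial indices: the root is \<open>[]\<close>, and the agent activated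
  by the \<open>i\<close>-th recommendation trial of agent \<open>v\<close> is \<open>v @ [i]\<close>. Decisions are drawn for all labels;
  only those of labels that are actually activated (the set \<open>agents\<close> below) matter.
\<close>

datatype decision =
    Halt                    \<comment> \<open>applies and is hired\<close>
  | Fail                    \<comment> \<open>applies and is not hired\<close>
  | Recommend "nat set"     \<comment> \<open>does not apply; indices of the successful trials\<close>

definition recommend_pmf :: "nat \<Rightarrow> real \<Rightarrow> decision pmf" where
  "recommend_pmf k p_r =
     map_pmf (\<lambda>b. Recommend {i. b i}) (Pi_pmf {..<k} False (\<lambda>_. bernoulli_pmf p_r))"

definition agent_pmf :: "nat \<Rightarrow> real \<Rightarrow> real \<Rightarrow> real \<Rightarrow> decision pmf" where
  "agent_pmf k p_r p_a p_h =
     bind_pmf (bernoulli_pmf p_a) (\<lambda>applies.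
       if applies then map_pmf (\<lambda>hired. if hired then Halt else Fail) (bernoulli_pmf p_h)
       else recommend_pmf k p_r)"

text \<open>
  The process started from the root agent, and the one started from a single activated (non-root)
  agent. They differ only in the law of the decision at the initial label \<open>[]\<close>.
\<close>

definition ihc_process :: "nat \<Rightarrow> real \<Rightarrow> real \<Rightarrow> real \<Rightarrow> (nat list \<Rightarrow> decision) measure" where
  "ihc_process k p_r p_a p_h =
     (\<Pi>\<^sub>M v\<in>UNIV. measure_pmf (if v = [] then recommend_pmf k p_r else agent_pmf k p_r p_a p_h))"

definition agent_process :: "nat \<Rightarrow> real \<Rightarrow> real \<Rightarrow> real \<Rightarrow> (nat list \<Rightarrow> decision) measure" where
  "agent_process k p_r p_a p_h = (\<Pi>\<^sub>M v\<in>UNIV. measure_pmf (agent_pmf k p_r p_a p_h))"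

inductive_set agents :: "(nat list \<Rightarrow> decision) \<Rightarrow> nat list set" for \<omega> where
  initial: "[] \<in> agents \<omega>"
| activated: "v \<in> agents \<omega> \<Longrightarrow> \<omega> v = Recommend S \<Longrightarrow> i \<in> S \<Longrightarrow> v @ [i] \<in> agents \<omega>"

definition some_halt :: "(nat list \<Rightarrow> decision) \<Rightarrow> bool" where
  "some_halt \<omega> \<longleftrightarrow> (\<exists>v\<in>agents \<omega>. \<omega> v = Halt)"

definition no_halt_prob :: "nat \<Rightarrow> real \<Rightarrow> real \<Rightarrow> real \<Rightarrow> real" where
  "no_halt_prob k p_r p_a p_h = \<P>(\<omega> in agent_process k p_r p_a p_h. \<not> some_halt \<omega>)"

definition P_fail :: "nat \<Rightarrow> real \<Rightarrow> real \<Rightarrow> real \<Rightarrow> real" where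
  "P_fail k p_h p_a p_r = \<P>(\<omega> in ihc_process k p_r p_a p_h. \<not> some_halt \<omega>)"

definition failure_boundary :: "nat \<Rightarrow> real \<Rightarrow> (real \<times> real) set" where
  "failure_boundary k p_h =
     {(p_a, p_r). p_a \<in> {0..1} \<and> p_r \<in> {0..1} \<and> P_fail k p_h p_a p_r = 1 / 2}"

end

theory Submission
  imports Defs
begin

text \<open>
  Both the event that nobody halts and the event that nobody halts and the tree is finite are
  hereditary: they hold at an agent iff its own decision is not a halt and they hold in the subtree
  of each of its children. Independence of the subtrees turns this into the same fixed-point equation
  \<open>x = f x\<close> for the two probabilities. If \<open>p_a p_h > 0\<close>, then \<open>f\<close> is convex on \<open>[0, 1]\<close> with
  \<open>f 1 = 1 - p_a p_h < 1\<close>, so the fixed point is unique, and halt-free infinite trees have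
  probability zero. If \<open>p_a p_h = 0\<close>, failure is almost sure, which excludes the failure boundary.
\<close>

section \<open>Recursive structure of the tree of agents\<close>

text \<open>The inductive definition extends labels at the end, while the branching recursion splits
  off the first index. Induction on the derivation bridges the two: the last activation step of a
  nonempty label either is the one that leaves the root or takes place inside the subtree at
  \<open>i\<close>.\<close>

lemma agents_Cons_iff:
  "i # w \<in> agents \<omega> \<longleftrightarrow> (\<exists>S. \<omega> [] = Recommend S \<and> i \<in> S \<and> w \<in> agents (\<lambda>v. \<omega> (i # v)))"
    (is "?L \<longleftrightarrow> ?R")
proof
  have "v \<in> agents \<omega> \<Longrightarrow> v = i # w \<Longrightarrow>
      \<exists>S. \<omega> [] = Recommend S \<and> i \<in> S \<and> w \<in> agents (\<lambda>v. \<omega> (i # v))" for v w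
  proof (induction arbitrary: w rule: agents.induct)
    case initial
    then show ?case by simp
  next
    case (activated v S j)
    show ?case
    proof (cases v)
      case Nil
      then show ?thesis
        using activated by (simp add: agents.initial)
    next
      case (Cons i' v')
      then have "\<exists>T. \<omega> [] = Recommend T \<and> i \<in> T \<and> v' \<in> agents (\<lambda>v. \<omega> (i # v))"
        and "w = v' @ [j]" and "\<omega> (i # v') = Recommend S"
        using activated by auto
      then show ?thesis
        using agents.activated[of v' "\<lambda>v. \<omega> (i # v)" S j] \<open>j \<in> S\<close> by blast
    qed
  qed
  then show "?L \<Longrightarrow> ?R" by blast
next
  assume ?R
  then obtain S where S: "\<omega> [] = Recommend S" "i \<in> S" and w: "w \<in> agents (\<lambda>v. \<omega> (i # v))"
    by blast
  from w show ?L
  proof (induction rule: agents.induct)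
    case initial
    then show ?case
      using agents.activated[of "[]" \<omega> S i] S by (simp add: agents.initial)
  next
    case (activated v T j)
    then show ?case
      using agents.activated[of "i # v" \<omega> T j] by simp
  qed
qed

lemma agents_unfold:
  "agents \<omega> = insert [] (case \<omega> [] of Recommend S \<Rightarrow> \<Union>i\<in>S. (#) i ` agents (\<lambda>v. \<omega> (i # v)) | _ \<Rightarrow> {})"
proof (rule set_eqI)
  fix v
  show "v \<in> agents \<omega> \<longleftrightarrow> v \<in> insert [] (case \<omega> [] of
      Recommend S \<Rightarrow> \<Union>i\<in>S. (#) i ` agents (\<lambda>v. \<omega> (i # v)) | _ \<Rightarrow> {})"
    by (cases v) (auto simp: agents_Cons_iff agents.initial split: decision.splits)
qed

lemma not_some_halt_unfold:
  "\<not> some_halt \<omega> \<longleftrightarrow> (case \<omega> [] of Halt \<Rightarrow> False | Fail \<Rightarrow> True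
     | Recommend S \<Rightarrow> \<forall>i\<in>S. \<not> some_halt (\<lambda>v. \<omega> (i # v)))"
  unfolding some_halt_def
  by (subst agents_unfold) (auto split: decision.splits)

text \<open>The tree is the root together with one injective copy of each subtree. Finite branching
  at the root is assumed because infinitely many finite subtrees form an infinite union.\<close>

lemma finite_agents_unfold:
  assumes "\<And>S. \<omega> [] = Recommend S \<Longrightarrow> finite S"
  shows "finite (agents \<omega>) \<longleftrightarrow> (case \<omega> [] of
     Recommend S \<Rightarrow> \<forall>i\<in>S. finite (agents (\<lambda>v. \<omega> (i # v))) | _ \<Rightarrow> True)"
  using assms
  by (subst agents_unfold) (auto split: decision.splits simp: finite_image_iff)

section \<open>Measurability of the events\<close>

text \<open>Whether \<open>v @ [i]\<close> is activated depends only on whether \<open>v\<close> is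
  and on the single coordinate at \<open>v\<close>, so induction from the end of the label applies.
  The factors carry the full power set as their sigma-algebra but are otherwise arbitrary, which
  covers both processes.\<close>

lemma agents_measurable:
  assumes "\<And>v. sets (M v) = UNIV"
  shows "Measurable.pred (PiM UNIV M) (\<lambda>\<omega>. v \<in> agents \<omega>)"
proof (induction v rule: rev_induct)
  case Nil
  then show ?case by (simp add: agents.initial)
next
  case (snoc i v)
  have "v @ [i] \<in> agents \<omega> \<longleftrightarrow> v \<in> agents \<omega> \<and> \<omega> v \<in> {Recommend S | S. i \<in> S}" for \<omega>
    by (auto elim: agents.cases intro: agents.intros)
  moreover have "Measurable.pred (PiM UNIV M) (\<lambda>\<omega>. \<omega> v \<in> {Recommend S | S. i \<in> S})"
    by (rule measurable_compose[OF measurable_component_singleton[of v UNIV M]])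
       (auto simp: pred_def assms)
  ultimately show ?case
    using snoc by simp
qed

lemma some_halt_measurable:
  assumes "\<And>v. sets (M v) = UNIV"
  shows "Measurable.pred (PiM UNIV M) some_halt"
proof -
  have "Measurable.pred (PiM UNIV M) (\<lambda>\<omega>. \<omega> v = Halt)" for v
    by (rule measurable_compose[OF measurable_component_singleton[of v UNIV M]])
       (auto simp: pred_def assms)
  then have "Measurable.pred (PiM UNIV M) (\<lambda>\<omega>. \<exists>v. v \<in> agents \<omega> \<and> \<omega> v = Halt)"
    using agents_measurable[of M, OF assms] by measurable
  then show ?thesis
    by (simp add: some_halt_def[abs_def] Bex_def)
qed

lemma finite_agents_measurable:
  assumes "\<And>v. sets (M v) = UNIV"
  shows "Measurable.pred (PiM UNIV M) (\<lambda>\<omega>. finite (agents \<omega>))"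
proof -
  \<comment> \<open>quantify over the countably many lists of labels instead of over sets of labels\<close>
  have "finite (agents \<omega>) \<longleftrightarrow> (\<exists>vs. \<forall>v. v \<in> agents \<omega> \<longrightarrow> v \<in> set vs)" for \<omega>
    by (metis List.finite_set finite_list finite_subset subsetI)
  moreover have "Measurable.pred (PiM UNIV M) (\<lambda>\<omega>. \<exists>vs. \<forall>v. v \<in> agents \<omega> \<longrightarrow> v \<in> set vs)"
    using agents_measurable[of M, OF assms] by measurable
  ultimately show ?thesis
    by simp
qed

section \<open>Independence of the subtrees and the recursion for hereditary events\<close>

text \<open>The root label and the sets of labels with a fixed first index are disjoint blocks of
  independent coordinates. Within the block of index \<open>i\<close>, deleting \<open>i\<close>
  from the front gives a process with law \<open>N\<close>, since no label there is the
  root.\<close>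

lemma prob_root_and_subtrees:
  fixes r a :: "'a pmf" and d :: 'a
  defines "M \<equiv> (\<Pi>\<^sub>M v\<in>UNIV. measure_pmf (if v = ([] :: nat list) then r else a))"
    and "N \<equiv> (\<Pi>\<^sub>M v\<in>(UNIV :: nat list set). measure_pmf a)"
  assumes B: "B \<in> sets N" and I: "finite I"
  shows "\<P>(\<omega> in M. \<omega> [] = d \<and> (\<forall>i\<in>I. (\<lambda>v. \<omega> (i # v)) \<in> B)) = pmf r d * measure N B ^ card I"
proof -
  define D where "D = (\<lambda>v. measure_pmf (if v = ([] :: nat list) then r else a))"
  have D: "prob_space (D v)" "sets (D v) = UNIV" "space (D v) = UNIV" for v
    by (auto simp: D_def prob_space_measure_pmf)
  interpret M: prob_space M
    unfolding M_def by (intro prob_space_PiM prob_space_measure_pmf)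
  have M_eq: "M = PiM UNIV D"
    by (simp add: M_def D_def)
  have comp: "(\<lambda>\<omega>. \<omega> v) \<in> measurable M (D v)" for v
    unfolding M_eq by simp
  have "distr M (D v) (\<lambda>\<omega>. \<omega> v) = D v" for v
    unfolding M_eq using D by (intro distr_PiM_component) auto
  \<comment> \<open>Independence means that the joint law of the coordinates is the product of their
    laws; here the joint map is the identity and \<open>M\<close> is that product.\<close>
  then have "M.indep_vars D (\<lambda>v \<omega>. \<omega> v) UNIV"
    using M.indep_vars_iff_distr_eq_PiM'[where I = UNIV and M' = D and X = "\<lambda>v \<omega>. \<omega> v"] comp
    by (simp add: M_eq restrict_UNIV)
  \<comment> \<open>\<open>None\<close> indexes the root block and \<open>Some i\<close> the labels
    that start with \<open>i\<close>.\<close>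
  moreover define K where "K = (\<lambda>j. case j of None \<Rightarrow> {[] :: nat list} | Some i \<Rightarrow> range ((#) i))"
  have "disjoint_family_on K UNIV"
    by (auto simp: disjoint_family_on_def K_def split: option.splits)
  ultimately have ind: "M.indep_vars (\<lambda>j. PiM (K j) D) (\<lambda>j \<omega>. restrict \<omega> (K j)) UNIV"
    by (intro M.indep_vars_restrict) auto
  have N_eq: "N = (\<Pi>\<^sub>M v\<in>UNIV. D (i # v))" for i
    by (simp add: N_def D_def)
  have shift: "(\<lambda>\<omega> v. \<omega> (i # v)) \<in> measurable (PiM (K (Some i)) D) N" for i
    unfolding N_eq[of i] by (intro measurable_PiM_single') (auto simp: K_def D)
  have shiftM: "(\<lambda>\<omega> v. \<omega> (i # v)) \<in> measurable M N" for i
    unfolding N_eq[of i] M_eq by (intro measurable_PiM_single') (auto simp: D)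
  have shift_distr: "distr M N (\<lambda>\<omega> v. \<omega> (i # v)) = N" for i
    using distr_PiM_reindex[of UNIV D "(#) i" UNIV] D
    by (simp add: M_eq N_eq[of i] restrict_UNIV)
  have prob_shift: "M.prob {\<omega> \<in> space M. (\<lambda>v. \<omega> (i # v)) \<in> B} = measure N B" for i
  proof -
    have "measure (distr M N (\<lambda>\<omega> v. \<omega> (i # v))) B = M.prob {\<omega> \<in> space M. (\<lambda>v. \<omega> (i # v)) \<in> B}"
      by (subst measure_distr[OF shiftM B]) (auto intro: arg_cong[where f = M.prob])
    then show ?thesis by (simp add: shift_distr)
  qed
  have prob_root: "M.prob {\<omega> \<in> space M. \<omega> [] = d} = pmf r d"
  proof -
    have "distr M (D []) (\<lambda>\<omega>. \<omega> []) = D []"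
      unfolding M_eq using D by (intro distr_PiM_component) auto
    moreover have "measure (distr M (D []) (\<lambda>\<omega>. \<omega> [])) {d} = M.prob {\<omega> \<in> space M. \<omega> [] = d}"
      by (subst measure_distr[OF comp]) (auto simp: D intro: arg_cong[where f = M.prob])
    ultimately have "measure (D []) {d} = M.prob {\<omega> \<in> space M. \<omega> [] = d}"
      by simp
    then show ?thesis
      by (simp add: D_def measure_pmf_single)
  qed
  \<comment> \<open>The required events, restated on the restrictions to the blocks so that block
    independence applies.\<close>
  define A where "A = (\<lambda>j. case j of None \<Rightarrow> {f \<in> space (PiM (K None) D). f [] = d}
    | Some i \<Rightarrow> {f \<in> space (PiM (K (Some i)) D). (\<lambda>v. f (i # v)) \<in> B})"
  have A: "A j \<in> sets (PiM (K j) D)" for j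
  proof (cases j)
    case None
    have "(\<lambda>f. f []) \<in> measurable (PiM (K None) D) (D [])"
      by (intro measurable_component_singleton) (simp add: K_def)
    from measurable_sets[OF this, of "{d}"] show ?thesis
      using None by (simp add: A_def D vimage_def Int_def conj_commute)
  next
    case (Some i)
    from measurable_sets[OF shift B] show ?thesis
      using Some by (simp add: A_def vimage_def Int_def conj_commute)
  qed
  have restrict_space: "restrict \<omega> X \<in> space (PiM X D)" for \<omega> X
    by (auto simp: space_PiM D)
  have pre_None: "(\<lambda>\<omega>. restrict \<omega> (K None)) -` A None \<inter> space M = {\<omega> \<in> space M. \<omega> [] = d}"
    by (auto simp: A_def restrict_space) (auto simp: K_def)
  have pre_Some: "(\<lambda>\<omega>. restrict \<omega> (K (Some i))) -` A (Some i) \<inter> space M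
      = {\<omega> \<in> space M. (\<lambda>v. \<omega> (i # v)) \<in> B}" for i
    by (auto simp: A_def restrict_space) (auto simp: K_def)
  define J where "J = insert None (Some ` I)"
  have J: "finite J" "J \<noteq> {}"
    using I by (auto simp: J_def)
  have "{\<omega> \<in> space M. \<omega> [] = d \<and> (\<forall>i\<in>I. (\<lambda>v. \<omega> (i # v)) \<in> B)}
      = (\<Inter>j\<in>J. (\<lambda>\<omega>. restrict \<omega> (K j)) -` A j \<inter> space M)"
    unfolding J_def by (simp only: INF_insert INF_image o_def pre_None pre_Some) auto
  also have "M.prob \<dots> = (\<Prod>j\<in>J. M.prob ((\<lambda>\<omega>. restrict \<omega> (K j)) -` A j \<inter> space M))"
    using J A by (intro M.indep_varsD[OF ind]) auto
  also have "\<dots> = pmf r d * measure N B ^ card I"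
    using I by (simp add: J_def pre_None pre_Some prob_root prob_shift prod.reindex)
  finally show ?thesis .
qed

text \<open>If \<open>u\<close> is the probability of a hereditary event for one child, this is its
  conditional probability given the decision \<open>d\<close> of the initial agent. It serves both
  for absence of halts and for halt-free extinction.\<close>

definition no_halt_weight :: "real \<Rightarrow> decision \<Rightarrow> real" where
  "no_halt_weight u d = (case d of Halt \<Rightarrow> 0 | Fail \<Rightarrow> 1 | Recommend S \<Rightarrow> u ^ card S)"

text \<open>Condition on the initial decision, which has finitely many values; given
  \<open>Recommend S\<close>, the event is the intersection of \<open>card S\<close> independent
  copies. The initial law \<open>r\<close> is kept separate from \<open>a\<close> to treat both
  processes at once, and \<open>Q_iff\<close> is required only on the support of \<open>r\<close>,
  where branching is finite.\<close>

lemma prob_hereditary: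
  fixes r a :: "decision pmf" and k :: nat
  defines "M \<equiv> (\<Pi>\<^sub>M v\<in>UNIV. measure_pmf (if v = ([] :: nat list) then r else a))"
    and "N \<equiv> (\<Pi>\<^sub>M v\<in>(UNIV :: nat list set). measure_pmf a)"
  assumes r: "set_pmf r \<subseteq> {Halt, Fail} \<union> Recommend ` Pow {..<k}"
    and Q: "\<And>M. (\<And>v. sets (M v) = UNIV) \<Longrightarrow> Measurable.pred (PiM UNIV M) Q"
    and Q_iff: "\<And>\<omega>. \<omega> [] \<in> set_pmf r \<Longrightarrow> Q \<omega> \<longleftrightarrow> (case \<omega> [] of Halt \<Rightarrow> False | Fail \<Rightarrow> True
      | Recommend S \<Rightarrow> \<forall>i\<in>S. Q (\<lambda>v. \<omega> (i # v)))"
  shows "\<P>(\<omega> in M. Q \<omega>) = measure_pmf.expectation r (no_halt_weight \<P>(\<omega> in N. Q \<omega>))"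
proof -
  define u where "u = \<P>(\<omega> in N. Q \<omega>)"
  define B where "B = {\<omega> \<in> space N. Q \<omega>}"
  have B: "B \<in> sets N"
    using Q[of "\<lambda>_. measure_pmf a"] by (simp add: B_def N_def pred_def)
  have u: "measure N B = u"
    by (simp add: u_def B_def)
  have space: "space N = UNIV" "space M = UNIV"
    by (auto simp: N_def M_def space_PiM)
  have QB: "\<omega> \<in> B \<longleftrightarrow> Q \<omega>" for \<omega>
    by (simp add: B_def space)
  interpret M: prob_space M
    unfolding M_def by (intro prob_space_PiM prob_space_measure_pmf)
  define F where "F = set_pmf r"
  have F: "finite F"
    unfolding F_def using r by (rule finite_subset) simp
  have meas: "Measurable.pred M Q" "Measurable.pred M (\<lambda>\<omega>. \<omega> [] = d)" for d
  proof -
    show "Measurable.pred M Q"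
      unfolding M_def by (rule Q) simp
    show "Measurable.pred M (\<lambda>\<omega>. \<omega> [] = d)"
      unfolding M_def
      by (rule measurable_compose[OF measurable_component_singleton[of "[]" UNIV]]) auto
  qed
  \<comment> \<open>Initial decisions outside the support form a null set, so a finite sum over
    \<open>F\<close> suffices.\<close>
  have root: "AE \<omega> in M. \<omega> [] \<in> F"
    unfolding M_def F_def
    by (rule AE_PiM_component) (auto intro: prob_space_measure_pmf AE_measure_pmf)
  have events: "{\<omega> \<in> space M. Q \<omega> \<and> \<omega> [] = d} \<in> M.events" for d
    using pred_intros_logic(3)[OF meas(1) meas(2)[of d]] by (simp add: pred_def)
  have weight: "M.prob {\<omega> \<in> space M. Q \<omega> \<and> \<omega> [] = d} = pmf r d * no_halt_weight u d"
    if d: "d \<in> F" for d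
  proof (cases d)
    case Halt
    then have none: "{\<omega> \<in> space M. Q \<omega> \<and> \<omega> [] = d} = {}"
      using d Q_iff by (auto simp: F_def)
    show ?thesis
      unfolding none using Halt by (simp add: no_halt_weight_def)
  next
    \<comment> \<open>The instance with no subtrees: the empty index set gives the factor 1.\<close>
    case Fail
    then have "{\<omega> \<in> space M. Q \<omega> \<and> \<omega> [] = d} = {\<omega> \<in> space M. \<omega> [] = d \<and> (\<forall>i\<in>{}. (\<lambda>v. \<omega> (i # v)) \<in> B)}"
      using d Q_iff by (auto simp: F_def)
    then show ?thesis
      using Fail prob_root_and_subtrees[of B a "{}" r d] B unfolding M_def[symmetric] N_def[symmetric]
      by (simp add: no_halt_weight_def)
  next
    case (Recommend S)
    then have S: "finite S"
      using d r by (auto simp: F_def intro: finite_subset)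
    have "{\<omega> \<in> space M. Q \<omega> \<and> \<omega> [] = d} = {\<omega> \<in> space M. \<omega> [] = d \<and> (\<forall>i\<in>S. (\<lambda>v. \<omega> (i # v)) \<in> B)}"
      using d Recommend Q_iff by (auto simp: F_def QB)
    then show ?thesis
      using Recommend prob_root_and_subtrees[of B a S r d] B S
      unfolding M_def[symmetric] N_def[symmetric]
      by (simp add: no_halt_weight_def u)
  qed
  have "M.prob {\<omega> \<in> space M. Q \<omega>} = M.prob (\<Union>d\<in>F. {\<omega> \<in> space M. Q \<omega> \<and> \<omega> [] = d})"
  proof (rule M.finite_measure_eq_AE)
    show "AE \<omega> in M. \<omega> \<in> {\<omega> \<in> space M. Q \<omega>} \<longleftrightarrow> \<omega> \<in> (\<Union>d\<in>F. {\<omega> \<in> space M. Q \<omega> \<and> \<omega> [] = d})"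
      using root by eventually_elim auto
  qed (use F events meas(1) in \<open>auto simp: pred_def\<close>)
  also have "\<dots> = (\<Sum>d\<in>F. M.prob {\<omega> \<in> space M. Q \<omega> \<and> \<omega> [] = d})"
  proof (rule M.finite_measure_finite_Union[OF F])
    show "(\<lambda>d. {\<omega> \<in> space M. Q \<omega> \<and> \<omega> [] = d}) ` F \<subseteq> M.events"
      using events by blast
    show "disjoint_family_on (\<lambda>d. {\<omega> \<in> space M. Q \<omega> \<and> \<omega> [] = d}) F"
      by (auto simp only: disjoint_family_on_def)
  qed
  also have "\<dots> = (\<Sum>d\<in>F. pmf r d * no_halt_weight u d)"
    by (simp add: weight)
  also have "\<dots> = measure_pmf.expectation r (no_halt_weight u)"
    using F by (subst integral_measure_pmf[of F]) (auto simp: F_def)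
  finally show ?thesis
    by (simp add: u_def)
qed

section \<open>Support and generating function of the decision laws\<close>

lemma set_recommend_pmf: "set_pmf (recommend_pmf k p_r) \<subseteq> Recommend ` Pow {..<k}"
proof -
  have "{i. b i} \<subseteq> {..<k}" if "b \<in> set_pmf (Pi_pmf {..<k} False (\<lambda>_. bernoulli_pmf p_r))" for b
    using that set_Pi_pmf_subset[of "{..<k}" False "\<lambda>_. bernoulli_pmf p_r"] by auto
  then show ?thesis
    by (auto simp: recommend_pmf_def)
qed

lemma set_agent_pmf: "set_pmf (agent_pmf k p_r p_a p_h) \<subseteq> {Halt, Fail} \<union> Recommend ` Pow {..<k}"
  using set_recommend_pmf[of k p_r] by (auto simp: agent_pmf_def split: if_splits)

text \<open>This is the generating function of the binomial law with parameters \<open>k\<close> and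
  \<open>p_r\<close>: the power of \<open>u\<close> splits into one factor per trial, and the trials
  are independent.\<close>

lemma expectation_recommend_pmf:
  assumes "p_r \<in> {0..1}" "u \<ge> 0"
  shows "measure_pmf.expectation (recommend_pmf k p_r) (no_halt_weight u) = (1 - p_r + p_r * u) ^ k"
proof -
  let ?P = "Pi_pmf {..<k} False (\<lambda>_. bernoulli_pmf p_r)"
  have "measure_pmf.expectation (recommend_pmf k p_r) (no_halt_weight u)
      = measure_pmf.expectation ?P (\<lambda>b. u ^ card {i. b i})"
    by (simp add: recommend_pmf_def no_halt_weight_def)
  also have "\<dots> = measure_pmf.expectation ?P (\<lambda>b. \<Prod>i<k. if b i then u else 1)"
  proof (rule integral_cong_AE)
    show "AE b in ?P. u ^ card {i. b i} = (\<Prod>i<k. if b i then u else 1)"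
    proof (rule AE_pmfI)
      fix b assume "b \<in> set_pmf ?P"
      \<comment> \<open>Outside \<open>{..<k}\<close> the default value \<open>False\<close>
        applies, so only actual trials are counted.\<close>
      then have "{i. b i} = {i\<in>{..<k}. b i}"
        using set_Pi_pmf_subset[of "{..<k}" False "\<lambda>_. bernoulli_pmf p_r"] by auto
      then show "u ^ card {i. b i} = (\<Prod>i<k. if b i then u else 1)"
        by (simp add: prod.If_cases Int_def)
    qed
  qed auto
  also have "\<dots> = (\<Prod>i<k. measure_pmf.expectation (bernoulli_pmf p_r) (\<lambda>b. if b then u else 1))"
    by (rule expectation_prod_Pi_pmf) (use assms in \<open>auto intro: integrable_measure_pmf_finite\<close>)
  also have "\<dots> = (1 - p_r + p_r * u) ^ k"
    using assms by (simp add: algebra_simps)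
  finally show ?thesis .
qed

lemma expectation_agent_pmf:
  assumes "p_r \<in> {0..1}" "p_a \<in> {0..1}" "p_h \<in> {0..1}" "u \<ge> 0"
  shows "measure_pmf.expectation (agent_pmf k p_r p_a p_h) (no_halt_weight u)
    = p_a * (1 - p_h) + (1 - p_a) * (1 - p_r + p_r * u) ^ k"
proof -
  have fin: "finite (set_pmf (recommend_pmf k p_r))"
    by (rule finite_subset[OF set_recommend_pmf]) simp
  show ?thesis
    unfolding agent_pmf_def
    using assms fin
    by (subst pmf_expectation_bind[of UNIV])
       (auto simp: UNIV_bool expectation_recommend_pmf no_halt_weight_def)
qed

section \<open>Convexity and uniqueness of the fixed point\<close>

text \<open>To the right of a fixed point \<open>x\<close>, the graph lies on or below the chord
  from \<open>(x, x)\<close> to \<open>(1, f 1)\<close>, and this chord is strictly below the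
  diagonal because \<open>f 1 < 1\<close>. Hence no larger fixed point exists.\<close>

lemma convex_fixed_point_unique:
  fixes f :: "real \<Rightarrow> real"
  assumes f: "convex_on {0..1} f" "f 1 < 1"
    and x: "x \<in> {0..1}" "f x = x" and y: "y \<in> {0..1}" "f y = y"
  shows "x = y"
proof -
  have False if xy: "x < y" and x: "x \<in> {0..1}" "f x = x" and y: "y \<in> {0..1}" "f y = y" for x y
  proof -
    have y1: "y < 1"
      using y f(2) by (cases "y = 1") auto
    \<comment> \<open>The weight that writes \<open>y\<close> as a convex combination of
      \<open>x\<close> and 1.\<close>
    define t where "t = (y - x) / (1 - x)"
    have t: "0 < t" "t \<le> 1"
      using xy y1 by (auto simp: t_def)
    have "t * (1 - x) = y - x"
      using xy y1 by (simp add: t_def)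
    then have y_eq: "y = (1 - t) * x + t * 1"
      by (simp add: algebra_simps)
    have "f y \<le> (1 - t) * f x + t * f 1"
      using convex_onD[OF f(1), of t x 1] t x y_eq by simp
    also have "\<dots> < (1 - t) * x + t * 1"
      using t f(2) x by simp
    finally show False
      using y y_eq by simp
  qed
  from this[of x y] this[of y x] x y show ?thesis
    by (meson linorder_less_linear)
qed

lemma convex_on_power_affine:
  fixes c p :: real
  assumes "c \<ge> 0" "p \<ge> 0"
  shows "convex_on {0..1} (\<lambda>x. (c + p * x) ^ k)"
proof (rule convex_onI)
  fix t x y :: real
  assume t: "0 < t" "t < 1" and x: "x \<in> {0..1}" and y: "y \<in> {0..1}"
  \<comment> \<open>Odd powers are convex only on the nonnegative half-line, hence the sign
    conditions on \<open>c\<close> and \<open>p\<close>.\<close>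
  have "convex_on {0..} (\<lambda>x::real. x ^ k)"
    using convex_power_even[of k] convex_power_odd[of k] by (cases "even k") (auto intro: convex_on_subset)
  moreover have "c + p * x \<ge> 0" "c + p * y \<ge> 0"
    using assms x y by auto
  ultimately have "((1 - t) * (c + p * x) + t * (c + p * y)) ^ k \<le> (1 - t) * (c + p * x) ^ k + t * (c + p * y) ^ k"
    using convex_onD[of "{0..}" "\<lambda>x. x ^ k" t "c + p * x" "c + p * y"] t by simp
  then show "(c + p * ((1 - t) *\<^sub>R x + t *\<^sub>R y)) ^ k \<le> (1 - t) * (c + p * x) ^ k + t * (c + p * y) ^ k"
    by (simp add: algebra_simps)
qed simp

section \<open>The failure equations and the failure boundary\<close>

theorem proposition2:
  fixes k :: nat and p_r p_a p_h U :: real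
  assumes "k \<ge> 1"
    and "p_r \<in> {0..1}" and "p_a \<in> {0..1}" and "p_h \<in> {0..1}"
    and "U = no_halt_prob k p_r p_a p_h"
  shows "U = p_a * (1 - p_h) + (1 - p_a) * (1 - p_r + p_r * U) ^ k \<and>
    P_fail k p_h p_a p_r = (1 - p_r + p_r * U) ^ k \<and>
    ((p_a, p_r) \<in> failure_boundary k p_h \<longrightarrow>
      \<P>(\<omega> in ihc_process k p_r p_a p_h. some_halt \<omega>) = 1 / 2 \<and>
      \<P>(\<omega> in ihc_process k p_r p_a p_h. finite (agents \<omega>) \<and> \<not> some_halt \<omega>) = 1 / 2)"
proof -
  define N where "N = agent_process k p_r p_a p_h"
  define M where "M = ihc_process k p_r p_a p_h"
  define D where "D = \<P>(\<omega> in N. finite (agents \<omega>) \<and> \<not> some_halt \<omega>)"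
  define f where "f = (\<lambda>x. p_a * (1 - p_h) + (1 - p_a) * (1 - p_r + p_r * x) ^ k)"
  have U: "U = \<P>(\<omega> in N. \<not> some_halt \<omega>)"
    using assms(5) by (simp add: no_halt_prob_def N_def)
  have nonneg: "U \<ge> 0" "D \<ge> 0"
    by (simp_all add: U D_def)
  have meas_no_halt: "Measurable.pred (PiM UNIV M) (\<lambda>\<omega>. \<not> some_halt \<omega>)"
    and meas_extinct: "Measurable.pred (PiM UNIV M) (\<lambda>\<omega>. finite (agents \<omega>) \<and> \<not> some_halt \<omega>)"
    if "\<And>v. sets (M v) = UNIV" for M :: "nat list \<Rightarrow> decision measure"
    using some_halt_measurable[of M] finite_agents_measurable[of M] that by auto
  have extinct_unfold: "finite (agents \<omega>) \<and> \<not> some_halt \<omega> \<longleftrightarrow> (case \<omega> [] of Halt \<Rightarrow> False | Fail \<Rightarrow> True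
      | Recommend S \<Rightarrow> \<forall>i\<in>S. finite (agents (\<lambda>v. \<omega> (i # v))) \<and> \<not> some_halt (\<lambda>v. \<omega> (i # v)))"
    if "\<omega> [] \<in> set_pmf r" and "set_pmf r \<subseteq> {Halt, Fail} \<union> Recommend ` Pow {..<k}" for \<omega> r
  proof -
    have "finite S" if "\<omega> [] = Recommend S" for S
      using that \<open>\<omega> [] \<in> set_pmf r\<close> \<open>set_pmf r \<subseteq> _\<close> by (auto intro: finite_subset)
    then show ?thesis
      by (subst finite_agents_unfold, blast, subst not_some_halt_unfold) (auto split: decision.splits)
  qed
  have root: "set_pmf (recommend_pmf k p_r) \<subseteq> {Halt, Fail} \<union> Recommend ` Pow {..<k}"
    using set_recommend_pmf by blast
  note no_halt = prob_hereditary[OF _ meas_no_halt not_some_halt_unfold, where k = k]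
  have extinction: "\<P>(\<omega> in (\<Pi>\<^sub>M v\<in>UNIV. measure_pmf (if v = [] then r else a)).
        finite (agents \<omega>) \<and> \<not> some_halt \<omega>)
      = measure_pmf.expectation r (no_halt_weight
          \<P>(\<omega> in (\<Pi>\<^sub>M v\<in>UNIV. measure_pmf a). finite (agents \<omega>) \<and> \<not> some_halt \<omega>))"
    if r: "set_pmf r \<subseteq> {Halt, Fail} \<union> Recommend ` Pow {..<k}" for r a :: "decision pmf"
    by (rule prob_hereditary[OF r meas_extinct extinct_unfold[OF _ r]])
  \<comment> \<open>With the initial law equal to the law of all other agents, the process and its
    subtrees have the same law, so the recursion becomes a fixed-point equation.\<close>
  have fixU: "U = f U"
    using no_halt[OF set_agent_pmf, of p_r p_a p_h "agent_pmf k p_r p_a p_h"]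
      expectation_agent_pmf[OF assms(2-4) nonneg(1), of k]
    by (simp add: U N_def agent_process_def f_def)
  have fixD: "D = f D"
    using extinction[OF set_agent_pmf, of p_r p_a p_h "agent_pmf k p_r p_a p_h"]
      expectation_agent_pmf[OF assms(2-4) nonneg(2), of k]
    by (simp add: D_def N_def agent_process_def f_def)
  have fail: "P_fail k p_h p_a p_r = (1 - p_r + p_r * U) ^ k"
    using no_halt[OF root, of "agent_pmf k p_r p_a p_h"]
      expectation_recommend_pmf[OF assms(2) nonneg(1), of k]
    by (simp add: P_fail_def U N_def agent_process_def ihc_process_def)
  have extinct: "\<P>(\<omega> in M. finite (agents \<omega>) \<and> \<not> some_halt \<omega>) = (1 - p_r + p_r * D) ^ k"
    using extinction[OF root, of "agent_pmf k p_r p_a p_h"]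
      expectation_recommend_pmf[OF assms(2) nonneg(2), of k]
    by (simp add: D_def M_def N_def agent_process_def ihc_process_def)
  have boundary: "\<P>(\<omega> in M. some_halt \<omega>) = 1 / 2 \<and>
      \<P>(\<omega> in M. finite (agents \<omega>) \<and> \<not> some_halt \<omega>) = 1 / 2"
    if "P_fail k p_h p_a p_r = 1 / 2"
  proof
    interpret N: prob_space N
      unfolding N_def agent_process_def by (intro prob_space_PiM prob_space_measure_pmf)
    interpret M: prob_space M
      unfolding M_def ihc_process_def by (intro prob_space_PiM prob_space_measure_pmf)
    have "Measurable.pred M some_halt"
      unfolding M_def ihc_process_def by (rule some_halt_measurable) simp
    then have "\<P>(\<omega> in M. \<not> some_halt \<omega>) = 1 - \<P>(\<omega> in M. some_halt \<omega>)"
      by (intro M.prob_neg) (simp add: pred_def)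
    with that show "\<P>(\<omega> in M. some_halt \<omega>) = 1 / 2"
      by (simp add: P_fail_def M_def)
    have range: "U \<in> {0..1}" "D \<in> {0..1}"
      by (auto simp: U D_def)
    \<comment> \<open>Otherwise \<open>Halt\<close> has probability zero at each of the countably
      many labels, so failure has probability 1 instead of 1/2.\<close>
    have "p_a * p_h \<noteq> 0"
    proof
      assume "p_a * p_h = 0"
      \<comment> \<open>This covers both cases: \<open>p_a = 0\<close> (never applying) and
        \<open>p_h = 0\<close> (never hired).\<close>
      moreover have "True \<notin> set_pmf (bernoulli_pmf 0)"
        by (simp add: set_pmf_eq)
      ultimately have "Halt \<notin> set_pmf (agent_pmf k p_r p_a p_h)"
        using set_recommend_pmf[of k p_r] by (auto simp: agent_pmf_def split: if_splits)
      moreover have "Halt \<notin> set_pmf (recommend_pmf k p_r)"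
        using set_recommend_pmf[of k p_r] by auto
      ultimately have "AE \<omega> in M. \<omega> v \<noteq> Halt" for v
        unfolding M_def ihc_process_def
        by (intro AE_PiM_component prob_space_measure_pmf) (auto intro!: AE_pmfI)
      then have "AE \<omega> in M. \<forall>v. \<omega> v \<noteq> Halt"
        by (simp add: AE_all_countable)
      then have "AE \<omega> in M. \<not> some_halt \<omega>"
        by eventually_elim (simp add: some_halt_def)
      then have "\<P>(\<omega> in M. \<not> some_halt \<omega>) = 1"
        using \<open>Measurable.pred M some_halt\<close> by (subst M.prob_Collect_eq_1) auto
      with that show False
        by (simp add: P_fail_def M_def)
    qed
    moreover have "f 1 = 1 - p_a * p_h"
      by (simp add: f_def algebra_simps)
    ultimately have "f 1 < 1"
      using assms(3,4) by (simp add: zero_less_mult_iff less_le)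
    moreover have "convex_on {0..1} f"
      unfolding f_def using assms
      by (intro convex_on_add convex_on_cmul convex_on_power_affine) (auto simp: convex_on_const)
    ultimately have "D = U"
      using convex_fixed_point_unique range fixU fixD by metis
    \<comment> \<open>Failure and halt-free extinction from the root are the same function of
      \<open>U\<close> and of \<open>D\<close> respectively, so they have equal probability.\<close>
    then show "\<P>(\<omega> in M. finite (agents \<omega>) \<and> \<not> some_halt \<omega>) = 1 / 2"
      using extinct fail that by simp
  qed
  show ?thesis
    using fixU fail boundary by (auto simp: f_def M_def failure_boundary_def)
qed

end
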